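(* The tiling $\{\mathcal{T}_{-2/3}(N)\mid N\in\mathbb{Z}\}$ of $\mathbb{R}$ consists of (possibly degenerate) intervals with infinitely many different lengths.
   Context: For $r\in\mathbb{R}$ with $0<|r|<1$ let $\tau_r:\mathbb{Z}\to\mathbb{Z}$, $\tau_r(z)=-\lfloor rz\rfloor$, and $\tau_r^{-n}(x)=\{z\in\mathbb{Z}\mid\tau_r^n(z)=x\}$. The SRS tile of $x\in\mathbb{Z}$ is $\mathcal{T}_r(x)=\mathrm{Li}_{n\to\infty}(-r)^n\tau_r^{-n}(x)\subset\mathbb{R}$, where the lower Hausdorff limit $\mathrm{Li}_{n\to\infty}A_n$ is the set of all $t\in\mathbb{R}$ such that each neighbourhood of $t$ intersects $A_n$ for all sufficiently large $n$. Here $r=-2/3$. "Tiling" means that the tiles cover $\mathbb{R}$ and that two tiles with different indices have at most one common point. A degenerate interval is a single point. *)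

theory Defs
  imports Complex_Main
begin

definition srs_tau :: "real \<Rightarrow> int \<Rightarrow> int" where
  "srs_tau r z = - \<lfloor>r * of_int z\<rfloor>"

definition lower_hausdorff_limit :: "(nat \<Rightarrow> 'a::topological_space set) \<Rightarrow> 'a set" where
  "lower_hausdorff_limit A =
     {t. \<forall>U. open U \<and> t \<in> U \<longrightarrow> (\<forall>\<^sub>F n in sequentially. U \<inter> A n \<noteq> {})}"

(* The parameter is meant to satisfy 0 < \<bar>r\<bar> < 1.  Note that f ^^ n is n-fold iteration, so
   (srs_tau r ^^ n) -` {x} is the n-th iterated preimage of x. *)
definition srs_tile :: "real \<Rightarrow> int \<Rightarrow> real set" where
  "srs_tile r x = lower_hausdorff_limit
     (\<lambda>n. (\<lambda>z. (- r) ^ n * of_int z) ` ((srs_tau r ^^ n) -` {x}))"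

(* Overlaps are compared by index, not by set: equal tiles with different indices
   must also share at most one point. *)
definition is_tiling :: "('i \<Rightarrow> 'a set) \<Rightarrow> bool" where
  "is_tiling T \<longleftrightarrow>
     (\<Union>i. T i) = UNIV \<and>
     (\<forall>i j. i \<noteq> j \<longrightarrow> (\<forall>s\<in>T i \<inter> T j. \<forall>t\<in>T i \<inter> T j. s = t))"

end

theory Submission imports Defs begin

text \<open>
  For $r = -2/3$ the map $\tau_r$ is the lower adjoint of $u(N) = \lfloor 3N/2 \rfloor$, so
  $\tau_r^{-n}(N)$ is the set of integers in $(u^n(N-1), u^n(N)]$ and the tile of $N$ is
  $[K(N-1), K(N)]$ with $K(N) = \lim (2/3)^n u^n(N)$.  Since $N - 1 \le K(N) \le N$ these intervals
  cover the line, and they overlap in endpoints only.  From $K(u(N)) = \frac32 K(N)$ the tile of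
  $2^k + 1$ is $(2/3)^k$ times as long as that of $3^k + 1$.  Tiles have length at most $2$, and
  tiles of even index have length at least $2/3$, so the lengths at $2^k + 1$ are positive and
  tend to $0$.
\<close>

section \<open>Lower Hausdorff limits of scaled integer intervals\<close>

lemma lower_hausdorff_limit_scaled_int_intervals:
  fixes c :: "nat \<Rightarrow> real" and l u :: "nat \<Rightarrow> int"
  assumes c: "c \<longlonglongrightarrow> 0" "\<And>n. c n > 0"
    and l: "(\<lambda>n. c n * of_int (l n)) \<longlonglongrightarrow> a"
    and u: "(\<lambda>n. c n * of_int (u n)) \<longlonglongrightarrow> b"
    and lu: "\<And>n. l n < u n"
  shows "lower_hausdorff_limit (\<lambda>n. (\<lambda>z. c n * of_int z) ` {l n<..u n}) = {a..b}"
proof (intro equalityI subsetI)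
  fix t assume t: "t \<in> lower_hausdorff_limit (\<lambda>n. (\<lambda>z. c n * of_int z) ` {l n<..u n})"
  have hit: "\<forall>\<^sub>F n in sequentially. U \<inter> (\<lambda>z. c n * of_int z) ` {l n<..u n} \<noteq> {}"
    if "open U" "t \<in> U" for U
    using t that by (auto simp: lower_hausdorff_limit_def)
  have "t \<le> b"
  proof (rule ccontr)
    assume "\<not> t \<le> b"
    \<comment> \<open>The point s separates t from the limit b: the scaled sets would have to meet
      the half-line above s, while their right ends eventually lie below s. The left end is treated
      in the same way.\<close>
    then obtain s where s: "b < s" "s < t" using dense[of b t] by auto
    have "\<forall>\<^sub>F n in sequentially. False"
      using hit[OF open_greaterThan greaterThan_iff[THEN iffD2, OF s(2)]] order_tendstoD(2)[OF u s(1)]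
    proof eventually_elim
      case (elim n)
      then obtain z where "s < c n * of_int z" "z \<le> u n" using s by auto
      moreover have "c n * of_int z \<le> c n * of_int (u n)"
        using c(2)[of n] \<open>z \<le> u n\<close> by (intro mult_left_mono) auto
      ultimately show False using elim by linarith
    qed
    then show False by simp
  qed
  moreover have "a \<le> t"
  proof (rule ccontr)
    assume "\<not> a \<le> t"
    then obtain s where s: "t < s" "s < a" using dense[of t a] by auto
    have "\<forall>\<^sub>F n in sequentially. False"
      using hit[OF open_lessThan lessThan_iff[THEN iffD2, OF s(1)]] order_tendstoD(1)[OF l s(2)]
    proof eventually_elim
      case (elim n)
      then obtain z where "c n * of_int z < s" "l n < z" using s by auto
      moreover have "c n * of_int (l n) \<le> c n * of_int z"
        using c(2)[of n] \<open>l n < z\<close> by (intro mult_left_mono) auto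
      ultimately show False using elim by linarith
    qed
    then show False by simp
  qed
  ultimately show "t \<in> {a..b}" by simp
next
  fix t assume t: "t \<in> {a..b}"
  \<comment> \<open>Round t / c n down and clamp the result to the interval, which \<open>lu\<close>
    makes nonempty even when a = b. The clamp starts at l n + 1 because the interval is open on the
    left; the extra c n vanishes in the limit, leaving min b (max a t) = t.\<close>
  define z where "z n = min (u n) (max (l n + 1) \<lfloor>t / c n\<rfloor>)" for n
  have z: "z n \<in> {l n<..u n}" for n
    using lu[of n] by (auto simp: z_def)
  have "(\<lambda>n. c n * of_int \<lfloor>t / c n\<rfloor>) \<longlonglongrightarrow> t"
  proof (rule real_tendsto_sandwich)
    show "\<forall>\<^sub>F n in sequentially. t - c n \<le> c n * of_int \<lfloor>t / c n\<rfloor>"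
    proof (intro always_eventually allI)
      fix n
      have "t / c n - 1 \<le> of_int \<lfloor>t / c n\<rfloor>" by linarith
      from mult_left_mono[OF this, of "c n"] c(2)[of n]
      show "t - c n \<le> c n * of_int \<lfloor>t / c n\<rfloor>" by (simp add: algebra_simps)
    qed
    show "\<forall>\<^sub>F n in sequentially. c n * of_int \<lfloor>t / c n\<rfloor> \<le> t"
    proof (intro always_eventually allI)
      fix n
      have "of_int \<lfloor>t / c n\<rfloor> \<le> t / c n" by linarith
      from mult_left_mono[OF this, of "c n"] c(2)[of n]
      show "c n * of_int \<lfloor>t / c n\<rfloor> \<le> t" by simp
    qed
    show "(\<lambda>n. t - c n) \<longlonglongrightarrow> t" using tendsto_diff[OF tendsto_const c(1)] by simp
  qed simp
  then have "(\<lambda>n. min (c n * of_int (u n))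
      (max (c n * of_int (l n) + c n) (c n * of_int \<lfloor>t / c n\<rfloor>))) \<longlonglongrightarrow> min b (max (a + 0) t)"
    by (intro tendsto_min tendsto_max tendsto_add l u c(1))
  also have "(\<lambda>n. min (c n * of_int (u n))
      (max (c n * of_int (l n) + c n) (c n * of_int \<lfloor>t / c n\<rfloor>))) = (\<lambda>n. c n * of_int (z n))"
  proof
    fix n
    have "c n \<ge> 0" using c(2)[of n] by simp
    then show "min (c n * of_int (u n))
        (max (c n * of_int (l n) + c n) (c n * of_int \<lfloor>t / c n\<rfloor>)) = c n * of_int (z n)"
      by (simp add: z_def of_int_min of_int_max max_mult_distrib_left min_mult_distrib_left
          distrib_left)
  qed
  finally have lim: "(\<lambda>n. c n * of_int (z n)) \<longlonglongrightarrow> t" using t by simp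
  show "t \<in> lower_hausdorff_limit (\<lambda>n. (\<lambda>z. c n * of_int z) ` {l n<..u n})"
    unfolding lower_hausdorff_limit_def
  proof (intro CollectI allI impI, elim conjE)
    fix U :: "real set" assume "open U" "t \<in> U"
    then have "\<forall>\<^sub>F n in sequentially. c n * of_int (z n) \<in> U"
      using lim by (simp add: tendsto_def)
    then show "\<forall>\<^sub>F n in sequentially. U \<inter> (\<lambda>z. c n * of_int z) ` {l n<..u n} \<noteq> {}"
      by eventually_elim (use z in blast)
  qed
qed

section \<open>The adjoint map and iterated preimages\<close>

definition tau_adjoint :: "int \<Rightarrow> int" where
  "tau_adjoint N = 3 * N div 2"

text \<open>The map is the ceiling of 2z/3, and a ceiling is at most the integer M exactly when 2z
  \<le> 3M.\<close>

lemma srs_tau_le_iff: "srs_tau (-2/3) z \<le> M \<longleftrightarrow> z \<le> tau_adjoint M"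
proof -
  have "srs_tau (-2/3) z \<le> M \<longleftrightarrow> - M \<le> \<lfloor>-2/3 * real_of_int z\<rfloor>"
    by (auto simp: srs_tau_def)
  also have "\<dots> \<longleftrightarrow> real_of_int (2 * z) \<le> real_of_int (3 * M)"
    by (simp add: le_floor_iff) linarith
  also have "\<dots> \<longleftrightarrow> z \<le> tau_adjoint M"
    unfolding of_int_le_iff tau_adjoint_def by presburger
  finally show ?thesis .
qed

text \<open>Adjoints compose. Peeling off the outermost map replaces M by
  \<open>tau_adjoint M\<close>, so the induction needs M arbitrary.\<close>

lemma srs_tau_funpow_le_iff:
  "(srs_tau (-2/3) ^^ n) z \<le> M \<longleftrightarrow> z \<le> (tau_adjoint ^^ n) M"
proof (induction n arbitrary: M)
  case (Suc n)
  have "(srs_tau (-2/3) ^^ Suc n) z \<le> M \<longleftrightarrow> z \<le> (tau_adjoint ^^ n) (tau_adjoint M)"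
    unfolding funpow.simps o_apply srs_tau_le_iff by (rule Suc.IH)
  then show ?case by (simp add: funpow_swap1)
qed simp

lemma srs_tau_funpow_vimage:
  "(srs_tau (-2/3) ^^ n) -` {N} = {(tau_adjoint ^^ n) (N - 1)<..(tau_adjoint ^^ n) N}"
proof (rule set_eqI)
  fix z
  let ?y = "(srs_tau (-2/3) ^^ n) z"
  have "?y = N \<longleftrightarrow> \<not> ?y \<le> N - 1 \<and> ?y \<le> N"
    by linarith
  also have "\<dots> \<longleftrightarrow> z \<in> {(tau_adjoint ^^ n) (N - 1)<..(tau_adjoint ^^ n) N}"
    unfolding srs_tau_funpow_le_iff by (simp only: not_le greaterThanAtMost_iff)
  finally show "z \<in> (srs_tau (-2/3) ^^ n) -` {N} \<longleftrightarrow>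
      z \<in> {(tau_adjoint ^^ n) (N - 1)<..(tau_adjoint ^^ n) N}"
    by (simp only: vimage_singleton_eq)
qed

text \<open>Strictness keeps every iterated preimage nonempty, even if its scaled ends have the same
  limit.\<close>

lemma tau_adjoint_funpow_strict_mono: "strict_mono (tau_adjoint ^^ n)"
proof (induction n)
  case (Suc n)
  have "strict_mono tau_adjoint"
    unfolding tau_adjoint_def by (rule strict_monoI) presburger
  with Suc show ?case by (simp add: strict_mono_def)
qed (simp add: strict_mono_def)

lemma tau_adjoint_bounds:
  "3/2 * real_of_int N - 1/2 \<le> of_int (tau_adjoint N)"
  "of_int (tau_adjoint N) \<le> 3/2 * real_of_int N"
proof -
  have "3 * N - 1 \<le> 2 * tau_adjoint N" "2 * tau_adjoint N \<le> 3 * N"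
    unfolding tau_adjoint_def by presburger+
  then have "real_of_int (3 * N - 1) \<le> of_int (2 * tau_adjoint N)"
    "real_of_int (2 * tau_adjoint N) \<le> of_int (3 * N)"
    unfolding of_int_le_iff .
  then show "3/2 * real_of_int N - 1/2 \<le> of_int (tau_adjoint N)"
    "of_int (tau_adjoint N) \<le> 3/2 * real_of_int N"
    by simp_all
qed

section \<open>Endpoints as limits of scaled iterates\<close>

definition scaled_iterate :: "int \<Rightarrow> nat \<Rightarrow> real" where
  "scaled_iterate N n = (2/3) ^ n * of_int ((tau_adjoint ^^ n) N)"

text \<open>One rounding loses at most 1/2, which the scale (2/3)^(n+1) turns into (2/3)^n /
  3.\<close>

lemma scaled_iterate_Suc_le: "scaled_iterate N (Suc n) \<le> scaled_iterate N n"
  and scaled_iterate_Suc_ge: "scaled_iterate N n - (2/3) ^ n / 3 \<le> scaled_iterate N (Suc n)"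
  using mult_left_mono[OF tau_adjoint_bounds(1), of "(2/3) ^ Suc n" "(tau_adjoint ^^ n) N"]
    mult_left_mono[OF tau_adjoint_bounds(2), of "(2/3) ^ Suc n" "(tau_adjoint ^^ n) N"]
  by (simp_all add: scaled_iterate_def algebra_simps)

text \<open>The losses form a geometric series with sum 1. Keeping its tail (2/3)^n makes the bound
  inductive, since (2/3)^n - (2/3)^n / 3 = (2/3)^(n+1).\<close>

lemma scaled_iterate_lower: "of_int N - 1 + (2/3) ^ n \<le> scaled_iterate N n"
proof (induction n)
  case (Suc n)
  then show ?case using scaled_iterate_Suc_ge[of N n] by simp
qed (simp add: scaled_iterate_def)

lemma scaled_iterate_upper: "scaled_iterate N n \<le> of_int N"
proof (induction n)
  case (Suc n)
  then show ?case using scaled_iterate_Suc_le[of N n] by simp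
qed (simp add: scaled_iterate_def)

definition tile_end :: "int \<Rightarrow> real" where
  "tile_end N = lim (scaled_iterate N)"

lemma scaled_iterate_tendsto: "scaled_iterate N \<longlonglongrightarrow> tile_end N"
proof -
  have "decseq (scaled_iterate N)"
    by (intro decseq_SucI scaled_iterate_Suc_le)
  moreover have "of_int N - 1 \<le> scaled_iterate N n" for n
    using scaled_iterate_lower[of N n] zero_le_power[of "2/3::real" n] by linarith
  ultimately have "convergent (scaled_iterate N)"
    using decseq_convergent convergent_def by metis
  then show ?thesis
    by (simp add: tile_end_def convergent_LIMSEQ_iff)
qed

lemma tile_end_le: "tile_end N \<le> of_int N"
  by (rule LIMSEQ_le_const2[OF scaled_iterate_tendsto]) (simp add: scaled_iterate_upper)

lemma tile_end_ge: "of_int N - 1 \<le> tile_end N"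
proof (rule LIMSEQ_le_const[OF scaled_iterate_tendsto], intro exI allI impI)
  fix n
  show "of_int N - 1 \<le> scaled_iterate N n"
    using scaled_iterate_lower[of N n] zero_le_power[of "2/3::real" n] by linarith
qed

lemma tile_end_mono:
  assumes "M \<le> N"
  shows "tile_end M \<le> tile_end N"
proof (rule LIMSEQ_le[OF scaled_iterate_tendsto scaled_iterate_tendsto], intro exI allI impI)
  fix n
  have "(tau_adjoint ^^ n) M \<le> (tau_adjoint ^^ n) N"
    using tau_adjoint_funpow_strict_mono assms strict_mono_mono monoD by blast
  then show "scaled_iterate M n \<le> scaled_iterate N n"
    by (simp add: scaled_iterate_def)
qed

text \<open>Starting one iterate later only shifts the sequence; the factor 3/2 makes up for the
  missing power of 2/3.\<close>

lemma tile_end_tau_adjoint: "tile_end (tau_adjoint N) = 3/2 * tile_end N"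
proof -
  have "scaled_iterate (tau_adjoint N) = (\<lambda>n. 3/2 * scaled_iterate N (Suc n))"
    by (rule ext) (simp add: scaled_iterate_def funpow_swap1)
  moreover have "(\<lambda>n. 3/2 * scaled_iterate N (Suc n)) \<longlonglongrightarrow> 3/2 * tile_end N"
    by (intro tendsto_mult tendsto_const LIMSEQ_Suc scaled_iterate_tendsto)
  ultimately show ?thesis
    using scaled_iterate_tendsto[of "tau_adjoint N"] LIMSEQ_unique by metis
qed

text \<open>On 2a + e with e in {0, 1} the adjoint is exactly 3a + e, so each application trades a
  factor 2 for a factor 3 and keeps e. The two values of e serve the two ends of one tile.\<close>

lemma tile_end_pow:
  assumes "e \<in> {0, 1}"
  shows "tile_end (3 ^ k * m + e) = (3/2) ^ k * tile_end (2 ^ k * m + e)"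
proof (induction k arbitrary: m)
  case (Suc k)
  have "tau_adjoint (3 ^ k * (2 * m) + e) = 3 ^ Suc k * m + e"
    using assms by (auto simp: tau_adjoint_def)
  with tile_end_tau_adjoint[of "3 ^ k * (2 * m) + e"] Suc.IH[of "2 * m"] show ?case
    by (simp add: mult_ac)
qed simp

section \<open>Tiles as intervals and the tiling property\<close>

lemma srs_tile_eq: "srs_tile (-2/3) N = {tile_end (N - 1)..tile_end N}"
proof -
  have "srs_tile (-2/3) N = lower_hausdorff_limit (\<lambda>n. (\<lambda>z. (2/3) ^ n * of_int z) `
      {(tau_adjoint ^^ n) (N - 1)<..(tau_adjoint ^^ n) N})"
    unfolding srs_tile_def srs_tau_funpow_vimage by simp
  also have "\<dots> = {tile_end (N - 1)..tile_end N}"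
  proof (rule lower_hausdorff_limit_scaled_int_intervals)
    show "(\<lambda>n. (2/3) ^ n * real_of_int ((tau_adjoint ^^ n) (N - 1))) \<longlonglongrightarrow> tile_end (N - 1)"
      "(\<lambda>n. (2/3) ^ n * real_of_int ((tau_adjoint ^^ n) N)) \<longlonglongrightarrow> tile_end N"
      using scaled_iterate_tendsto by (simp_all add: scaled_iterate_def[abs_def])
    show "(tau_adjoint ^^ n) (N - 1) < (tau_adjoint ^^ n) N" for n
      using strict_monoD[OF tau_adjoint_funpow_strict_mono] by simp
  qed (auto intro: LIMSEQ_power_zero)
  finally show ?thesis .
qed

lemma is_tiling_srs_tile: "is_tiling (srs_tile (-2/3))"
  unfolding is_tiling_def
proof (intro conjI allI impI ballI)
  show "(\<Union>i. srs_tile (-2/3) i) = UNIV"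
  proof (intro equalityI subsetI UNIV_I)
    fix t :: real
    \<comment> \<open>Since t < \<lfloor>t\<rfloor> + 1 \<le> K(\<lfloor>t\<rfloor> + 2) and
      K(\<lfloor>t\<rfloor>) \<le> \<lfloor>t\<rfloor> \<le> t, one of the two tiles between these
      ends contains t.\<close>
    have upper: "t < tile_end (\<lfloor>t\<rfloor> + 2)"
      using tile_end_ge[of "\<lfloor>t\<rfloor> + 2"] by simp linarith
    have "\<exists>N \<in> {\<lfloor>t\<rfloor><..\<lfloor>t\<rfloor> + 2}. t \<in> {tile_end (N - 1)..tile_end N}"
    proof (cases "t \<le> tile_end (\<lfloor>t\<rfloor> + 1)")
      case True
      moreover have "tile_end \<lfloor>t\<rfloor> \<le> t"
        using tile_end_le[of "\<lfloor>t\<rfloor>"] by linarith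
      ultimately show ?thesis by (intro bexI[of _ "\<lfloor>t\<rfloor> + 1"]) auto
    next
      case False
      with upper show ?thesis by (intro bexI[of _ "\<lfloor>t\<rfloor> + 2"]) (auto simp: add.commute)
    qed
    then show "t \<in> (\<Union>i. srs_tile (-2/3) i)"
      unfolding srs_tile_eq by blast
  qed
next
  \<comment> \<open>For i < j a common point satisfies s \<le> K(i) \<le> K(j - 1) \<le> s.\<close>
  have meet: "s = tile_end i"
    if "i < j" "s \<in> srs_tile (-2/3) i \<inter> srs_tile (-2/3) j" for i j :: int and s
    using that tile_end_mono[of i "j - 1"] unfolding srs_tile_eq by auto
  fix i j :: int and s t
  assume "i \<noteq> j" "s \<in> srs_tile (-2/3) i \<inter> srs_tile (-2/3) j"
    "t \<in> srs_tile (-2/3) i \<inter> srs_tile (-2/3) j"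
  then show "s = t"
    using meet[of i j] meet[of j i] by (metis Int_commute linorder_neqE)
qed

section \<open>Lengths of the tiles\<close>

lemma tile_length_le: "tile_end N - tile_end (N - 1) \<le> 2"
  using tile_end_le[of N] tile_end_ge[of "N - 1"] by simp

text \<open>The adjoint moves the neighbours 2m - 1 and 2m to distance 2, which exceeds the
  uncertainty 1 in the position of an endpoint. From an odd index to its predecessor the distance
  would stay 1 and decide nothing.\<close>

lemma even_tile_length_pos: "tile_end (2 * m - 1) < tile_end (2 * m)"
proof -
  have "tau_adjoint (2 * m) = 3 * m" "tau_adjoint (2 * m - 1) = 3 * m - 2"
    unfolding tau_adjoint_def by presburger+
  then show ?thesis
    using tile_end_tau_adjoint[of "2 * m"] tile_end_tau_adjoint[of "2 * m - 1"]
      tile_end_ge[of "3 * m"] tile_end_le[of "3 * m - 2"]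
    by simp
qed

lemma infinite_tile_lengths: "infinite (range (\<lambda>N. tile_end N - tile_end (N - 1)))"
proof
  let ?L = "\<lambda>N. tile_end N - tile_end (N - 1)"
  assume fin: "finite (range ?L)"
  have scale: "?L (2 ^ k + 1) = (2/3) ^ k * ?L (3 ^ k + 1)" for k
    using tile_end_pow[of 0 k 1] tile_end_pow[of 1 k 1] by (simp add: power_divide field_simps)
  have pos: "0 < ?L (2 ^ k + 1)" for k
  proof -
    \<comment> \<open>The index 2^k + 1 is odd for k > 0, so positivity is taken from the even index
      3^k + 1 through \<open>scale\<close>.\<close>
    have "even (3 ^ k + 1 :: int)" by simp
    then obtain m :: int where "3 ^ k + 1 = 2 * m" by (elim evenE)
    then have "0 < ?L (3 ^ k + 1)"
      using even_tile_length_pos[of m] by simp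
    then show ?thesis unfolding scale by simp
  qed
  have "(\<lambda>k. ?L (2 ^ k + 1)) \<longlonglongrightarrow> 0"
  proof (rule real_tendsto_sandwich)
    show "\<forall>\<^sub>F k in sequentially. 0 \<le> ?L (2 ^ k + 1)"
      by (intro always_eventually allI less_imp_le pos)
    show "\<forall>\<^sub>F k in sequentially. ?L (2 ^ k + 1) \<le> (2/3) ^ k * 2"
    proof (intro always_eventually allI)
      fix k
      show "?L (2 ^ k + 1) \<le> (2/3) ^ k * 2"
        unfolding scale by (intro mult_left_mono tile_length_le) simp
    qed
    show "(\<lambda>k. (2/3) ^ k * 2 :: real) \<longlonglongrightarrow> 0"
      by (intro tendsto_mult_left_zero LIMSEQ_power_zero) simp
  qed simp
  \<comment> \<open>With finitely many lengths there would be a least positive one, but the positive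
    lengths at 2^k + 1 fall below it.\<close>
  moreover define e where "e = Min {x \<in> range ?L. 0 < x}"
  have nonempty: "{x \<in> range ?L. 0 < x} \<noteq> {}" using pos[of 0] by blast
  have "0 < e"
    using Min_in[OF _ nonempty] fin unfolding e_def by simp
  ultimately have "\<forall>\<^sub>F k in sequentially. ?L (2 ^ k + 1) < e"
    by (rule order_tendstoD)
  then obtain k where "?L (2 ^ k + 1) < e"
    using eventually_happens by force
  moreover have "e \<le> ?L (2 ^ k + 1)"
    unfolding e_def
  proof (rule Min_le)
    show "finite {x \<in> range ?L. 0 < x}" using fin by simp
    show "?L (2 ^ k + 1) \<in> {x \<in> range ?L. 0 < x}" using pos by blast
  qed
  ultimately show False by simp
qed

theorem corollary5p20:
  "is_tiling (srs_tile (-2/3)) \<and>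
   (\<exists>a b :: int \<Rightarrow> real.
      (\<forall>N. a N \<le> b N \<and> srs_tile (-2/3) N = {a N..b N}) \<and>
      infinite (range (\<lambda>N. b N - a N)))"
proof (intro conjI exI allI)
  show "srs_tile (-2/3) N = {tile_end (N - 1)..tile_end N}" for N
    by (rule srs_tile_eq)
  show "tile_end (N - 1) \<le> tile_end N" for N
    by (rule tile_end_mono) simp
qed (rule is_tiling_srs_tile infinite_tile_lengths)+

end
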